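(* Let $k,\ell,n$ be nonnegative integers with $\ell\le n$ and $k\le n$. Then \[ \sum_{m=0}^k \binom{k}{m}\binom{n}{m+\ell}\binom{2m+2\ell}{k+n} = \binom{n}{\ell}\binom{2\ell}{n-k}. \]
   Context: Binomial coefficients $\binom{p}{q}$ with nonnegative integers $p,q$ are the usual ones, with $\binom{p}{q}=0$ when $q>p$. *)

theory Defs
  imports Complex_Main
begin

end

theory Submission
  imports Defs
begin

text \<open>
  Write the sum as \<open>S l = (\<Sum>m\<le>k. (k choose m) * A (k + n) (m + l))\<close> with
  \<open>A p j = (n choose j) * (2 * j choose p)\<close>. The sequence \<open>A p\<close> satisfies a first-order
  recurrence in \<open>j\<close> with polynomial coefficients; subtracting it, weighted by \<open>k choose m\<close>, from
  the summand of \<open>2 (n - l) (2 l + 1) S l - (2 l + 2 + k - n) (2 l + 1 + k - n) S (l + 1)\<close>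
  leaves a telescoping sum, so this combination vanishes. The right-hand side is \<open>A (n - k) l\<close>,
  for which the recurrence of \<open>A\<close> is the same relation. Both sides agree at \<open>l = n\<close>, where
  only \<open>m = 0\<close> contributes, and downward induction on \<open>l\<close> concludes.
\<close>

text \<open>Absorption over the integers: at \<open>p = Suc a\<close> the left factor and the right
  binomial are zero, and beyond that both binomials vanish.\<close>

lemma Suc_minus_times_binomial:
  "(int a + 1 - int p) * int (Suc a choose p) = (int a + 1) * int (a choose p)"
proof (cases "p \<le> a")
  case True
  have "(Suc a - p) * (Suc a choose p) = Suc a * (a choose p)"
    using binomial_absorb_comp[of "Suc a" p] by simp
  then have "int (Suc a - p) * int (Suc a choose p) = int (Suc a) * int (a choose p)"
    by (metis of_nat_mult)
  with True show ?thesis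
    by (simp add: of_nat_diff algebra_simps)
next
  case False
  then show ?thesis
    by (cases "p = Suc a") (auto simp: binomial_eq_0)
qed

definition choose_double :: "nat \<Rightarrow> nat \<Rightarrow> nat \<Rightarrow> int" where
  "choose_double n p j = int (n choose j) * int (2 * j choose p)"

text \<open>Two absorption steps raise the upper index from \<open>2 * j\<close> to
  \<open>2 * j + 2\<close>; the factor \<open>2 * j + 2\<close> they produce is then used up in
  passing from \<open>n choose Suc j\<close> to \<open>n choose j\<close>.\<close>

lemma choose_double_Suc:
  "(2 * int j + 2 - int p) * (2 * int j + 1 - int p) * choose_double n p (Suc j)
    = 2 * (int n - int j) * (2 * int j + 1) * choose_double n p j"
proof -
  let ?C = "\<lambda>i. int (i choose p)"
  have top: "(2 * int j + 2 - int p) * ?C (2 * j + 2) = (2 * int j + 2) * ?C (2 * j + 1)"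
    using Suc_minus_times_binomial[of "2 * j + 1" p] by (simp add: algebra_simps)
  have "(2 * int j + 1 - int p) * ?C (2 * j + 1) = (2 * int j + 1) * ?C (2 * j)"
    using Suc_minus_times_binomial[of "2 * j" p] by (simp add: algebra_simps)
  then have upper: "(2 * int j + 2 - int p) * (2 * int j + 1 - int p) * ?C (2 * j + 2)
      = (2 * int j + 2) * (2 * int j + 1) * ?C (2 * j)"
    by (simp only: mult.assoc mult.left_commute[of _ "2 * int j + 1 - int p"] top)
      (simp only: mult.left_commute[of "2 * int j + 1 - int p"])
  have lower: "(int j + 1) * int (n choose Suc j) = (int n - int j) * int (n choose j)"
  proof (cases "j \<le> n")
    case True
    have "Suc j * (n choose Suc j) = (n - j) * (n choose j)"
      using binomial_absorption[of j n] binomial_absorb_comp[of n j] by simp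
    then have "int (Suc j) * int (n choose Suc j) = int (n - j) * int (n choose j)"
      by (metis of_nat_mult)
    with True show ?thesis
      by (simp add: of_nat_diff algebra_simps)
  qed (simp add: binomial_eq_0)
  have "(2 * int j + 2 - int p) * (2 * int j + 1 - int p) * choose_double n p (Suc j)
      = int (n choose Suc j)
        * ((2 * int j + 2 - int p) * (2 * int j + 1 - int p) * ?C (2 * j + 2))"
    by (simp add: choose_double_def ac_simps)
  also have "\<dots> = 2 * (2 * int j + 1) * ?C (2 * j) * ((int j + 1) * int (n choose Suc j))"
    unfolding upper by (simp add: algebra_simps)
  also have "\<dots> = 2 * (int n - int j) * (2 * int j + 1) * choose_double n p j"
    unfolding lower by (simp add: choose_double_def algebra_simps)
  finally show ?thesis .
qed

definition binomial_sum :: "nat \<Rightarrow> nat \<Rightarrow> nat \<Rightarrow> int" where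
  "binomial_sum k n l = (\<Sum>m\<le>k. int (k choose m) * choose_double n (k + n) (l + m))"

lemma binomial_sum_Suc:
  "(2 * int l + 2 + int k - int n) * (2 * int l + 1 + int k - int n) * binomial_sum k n (Suc l)
    = 2 * (int n - int l) * (2 * int l + 1) * binomial_sum k n l"
proof -
  let ?c = "\<lambda>m. int (k choose m)" and ?A = "\<lambda>m. choose_double n (k + n) (l + m)"
  define P where "P m = 2 * (int n - int (l + m)) * (2 * int (l + m) + 1)" for m
  define Q where
    "Q m = (2 * int (l + m) + 2 - int (k + n)) * (2 * int (l + m) + 1 - int (k + n))" for m
  \<comment> \<open>This is \<open>Q 0\<close> with \<open>n - k\<close> in place of
    \<open>k + n\<close>, and it equals \<open>Q k\<close>.\<close>
  define q where "q = (2 * int l + 2 + int k - int n) * (2 * int l + 1 + int k - int n)"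
  \<comment> \<open>The telescoping certificate: it vanishes at \<open>0\<close> by its middle
    factor and at \<open>Suc k\<close> by \<open>?c\<close>.\<close>
  define H where "H m = ?c m * (P 0 - P m) * ?A m" for m
  have rec: "Q m * ?A (Suc m) = P m * ?A m" for m
    using choose_double_Suc[of "l + m" "k + n" n] by (simp add: P_def Q_def)
  have shift: "?c (Suc m) * (P 0 - P (Suc m)) = ?c m * (q - Q m)" if "m \<le> k" for m
  proof -
    have "Suc m * (k choose Suc m) = (k - m) * (k choose m)"
      using binomial_absorption[of m k] binomial_absorb_comp[of k m] by simp
    then have "int (Suc m) * ?c (Suc m) = int (k - m) * ?c m"
      by (metis of_nat_mult)
    with that have absorb: "(int m + 1) * ?c (Suc m) = (int k - int m) * ?c m"
      by (simp add: of_nat_diff algebra_simps)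
    \<comment> \<open>The left difference has the root \<open>m = -1\<close>, the right one
      \<open>m = k\<close>; \<open>?t\<close> is their common cofactor, and absorption trades one
      root factor for the other.\<close>
    let ?t = "2 * (4 * int l + 2 * int m + 3 - 2 * int n)"
    have "P 0 - P (Suc m) = ?t * (int m + 1)" and "q - Q m = ?t * (int k - int m)"
      by (simp_all add: P_def Q_def q_def algebra_simps)
    then show ?thesis
      using absorb by (simp add: ac_simps)
  qed
  have diff: "P 0 * (?c m * ?A m) - q * (?c m * ?A (Suc m)) = H m - H (Suc m)" if "m \<le> k" for m
  proof -
    have "H (Suc m) = ?c m * (q - Q m) * ?A (Suc m)"
      using shift[OF that] by (simp add: H_def)
    moreover have "Q m * (?c m * ?A (Suc m)) = P m * (?c m * ?A m)"
      using rec[of m] by (metis mult.left_commute)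
    ultimately show ?thesis
      unfolding H_def[of m] left_diff_distrib right_diff_distrib
      by (simp only: mult.assoc mult.left_commute[of "?c m"])
  qed
  have "P 0 * binomial_sum k n l - q * binomial_sum k n (Suc l)
      = (\<Sum>m\<le>k. P 0 * (?c m * ?A m) - q * (?c m * ?A (Suc m)))"
    by (simp add: binomial_sum_def sum_subtractf sum_distrib_left)
  also have "\<dots> = (\<Sum>m\<le>k. H m - H (Suc m))"
    by (intro sum.cong) (simp_all only: diff atMost_iff)
  also have "\<dots> = H 0 - H (Suc k)"
    by (rule sum_telescope)
  also have "\<dots> = 0"
    by (simp add: H_def)
  finally show ?thesis
    by (simp add: P_def q_def)
qed

lemma binomial_sum_eq:
  assumes "l \<le> n" and "k \<le> n"
  shows "binomial_sum k n l = choose_double n (n - k) l"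
  using assms(1)
\<comment> \<open>Downward, since the coefficient at \<open>l\<close> is nonzero for
  \<open>l < n\<close>, while the one at \<open>Suc l\<close> can vanish.\<close>
proof (induction l rule: inc_induct)
  case base
  have "binomial_sum k n n = (\<Sum>m\<in>{0}. int (k choose m) * choose_double n (k + n) (n + m))"
    unfolding binomial_sum_def by (rule sum.mono_neutral_right) (auto simp: choose_double_def)
  also have "\<dots> = int (2 * n choose (k + n))"
    by (simp add: choose_double_def)
  \<comment> \<open>Symmetry about \<open>n\<close> turns the lower index \<open>k + n\<close> into
    \<open>n - k\<close>.\<close>
  also have "(2 * n choose (k + n)) = (2 * n choose (n - k))"
    using binomial_symmetric[of "k + n" "2 * n"] assms(2) by (simp add: mult_2)
  finally show ?case
    by (simp add: choose_double_def)
next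
  case (step l)
  have "2 * (int n - int l) * (2 * int l + 1) * binomial_sum k n l
      = 2 * (int n - int l) * (2 * int l + 1) * choose_double n (n - k) l"
    using binomial_sum_Suc[of l k n] choose_double_Suc[of l "n - k" n] step.IH assms(2)
    by (simp add: of_nat_diff algebra_simps)
  moreover have "2 * (int n - int l) * (2 * int l + 1) \<noteq> 0"
    using step.hyps by simp
  ultimately show ?case
    by simp
qed

theorem corollary4p4:
  fixes k l n :: nat
  assumes "l \<le> n" and "k \<le> n"
  shows "(\<Sum>m=0..k. (k choose m) * (n choose (m + l)) * ((2 * m + 2 * l) choose (k + n)))
    = (n choose l) * ((2 * l) choose (n - k))"
proof -
  have "int (\<Sum>m=0..k. (k choose m) * (n choose (m + l)) * ((2 * m + 2 * l) choose (k + n)))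
      = binomial_sum k n l"
    by (simp add: binomial_sum_def choose_double_def atLeast0AtMost mult.assoc add.commute)
  also have "\<dots> = int ((n choose l) * ((2 * l) choose (n - k)))"
    using binomial_sum_eq[OF assms] by (simp add: choose_double_def)
  finally show ?thesis
    by (simp only: of_nat_eq_iff)
qed

end
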